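(* Let $M,N$ be positive integers and $\tau=T/M$. Let $u_N^0=0$ and let $u_N^1,\dots,u_N^M\in V_N^0$ satisfy the ADI spectral scheme: for every $k=0,1,\dots,M-1$ and every $v\in V_N^0$, $$\Big(\delta_t u_N^{k+\frac12}, v\Big)+\sum_{i=1}^{Q}a_i\Big(D_\tau^{\beta_i,k+\frac12}u_N,v\Big)+\frac{q^2}{p^2}\Big(\partial_x\partial_y\delta_t u_N^{k+\frac12},\partial_x\partial_y v\Big)=-\mu\Big(D_\tau^{-\beta,k+\frac12}\nabla u_N,\nabla v\Big)+\Big(g^{k+\frac12},v\Big).$$ Under the condition $\tau<1$ the scheme is stable, in the sense that for all $1\le n\le M$ $$\|u_N^n\|^2\le \exp(2T)\Big(2\tau\sum_{k=0}^{n-1}\|g^{k+\frac12}\|^2\Big).$$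
   Context: Setting. $\Omega=I_x\times I_y=(-1,1)\times(-1,1)$, $T>0$; $(\cdot,\cdot)$ and $\|\cdot\|$ are the inner product and norm of $L^2(\Omega)$. The underlying problem is $${}_CD_{0,t}^{\alpha}u+\sum_{j=1}^{Q}a_j\,{}_CD_{0,t}^{\alpha_j}u=\mu\Delta u+f\quad\text{in }\Omega\times(0,T),$$ with $u(x,y,0)=g_1(x,y)$, $\partial_t u(x,y,0)=g_2(x,y)$, and $u=0$ on $\partial\Omega$, where ${}_CD_{0,t}^{\gamma}$ is the Caputo derivative of order $\gamma$ in $t$. Here $2>\alpha>\alpha_1>\dots>\alpha_{Q'}>1=\alpha_{Q'+1}>\dots>\alpha_Q>0$, $Q$ is an integer, and $a_j>0$, $\mu>0$. It is assumed throughout that $u(x,y,0)=0$ (i.e. $g_1=0$), and accordingly $u_N^0=0$. Put $\beta=\alpha-1$ and $\beta_j=\alpha_j-\alpha+1$. The Riemann-Liouville integral of order $\gamma>0$ is ${}_{RL}D_{0,t}^{-\gamma}w(t)=\frac{1}{\Gamma(\gamma)}\int_0^t(t-s)^{\gamma-1}w(s)\,ds$. The function $g$ is $$g=g_2+\sum_{j=1}^{Q'}a_j\,{}_{RL}D_{0,t}^{\alpha_j-\alpha}g_2+{}_{RL}D_{0,t}^{-\beta}f,$$ where $g_2=\partial_t u(\cdot,0)$ is regarded as constant in $t$; the data are such that $g(\cdot,t_n)\in L^2(\Omega)$ for all $n$. Discretization. $t_n=n\tau$ for $0\le n\le M$, and $w^n=w(\cdot,t_n)$ for a function $w$ of $(x,y,t)$.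 For any sequence $(w^n)$, $\delta_t w^{k+\frac12}=\frac{w^{k+1}-w^k}{\tau}$ and $w^{k+\frac12}=\frac{w^{k+1}+w^k}{2}$. For $\gamma\in[-1,1]$ define $g_j^{(\gamma)}=(-1)^j\binom{\gamma}{j}$ for $j\ge0$, $\lambda_0^{(\gamma)}=(1+\frac{\gamma}{2})g_0^{(\gamma)}$, $\lambda_j^{(\gamma)}=(1+\frac{\gamma}{2})g_j^{(\gamma)}-\frac{\gamma}{2}g_{j-1}^{(\gamma)}$ for $j\ge1$, and $$D_\tau^{\gamma,n}w=\tau^{-\gamma}\sum_{j=0}^{n}\lambda_j^{(\gamma)}w^{n-j},\qquad D_\tau^{\gamma,k+\frac12}w=\tfrac12\big(D_\tau^{\gamma,k+1}w+D_\tau^{\gamma,k}w\big).$$ The constants $p>0$ and $q$ are given by $$p^2=1+\frac12\sum_{i=1}^{Q}a_i\lambda_0^{(\beta_i)}\tau^{1-\beta_i},\qquad q=\frac{\mu}{2}\lambda_0^{(-\beta)}\tau^{1+\beta}.$$ $P_N(I)$ is the space of polynomials of degree at most $N$ on the interval $I$, and $V_N^0=\big(P_N(I_x)\otimes P_N(I_y)\big)\cap H_0^1(\Omega)$. *)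

theory Defs
  imports "HOL-Analysis.Analysis" "HOL-Computational_Algebra.Polynomial"
begin

text \<open>
  A function on the square is represented by a total function on the plane. Its values
  outside the open square are irrelevant. (Test functions are the exception: they stand for
  their extension by zero.)
\<close>

definition \<Omega> :: "(real \<times> real) set" where
  "\<Omega> = {-1<..<1} \<times> {-1<..<1}"

definition L2 :: "(real \<times> real \<Rightarrow> 'a::euclidean_space) set" where
  "L2 = {f. f \<in> borel_measurable (lebesgue_on \<Omega>) \<and>
            integrable (lebesgue_on \<Omega>) (\<lambda>z. (norm (f z))\<^sup>2)}"

definition L2_inner ::
    "(real \<times> real \<Rightarrow> 'a::euclidean_space) \<Rightarrow> (real \<times> real \<Rightarrow> 'a) \<Rightarrow> real" where
  "L2_inner f g = (LINT z|lebesgue_on \<Omega>. f z \<bullet> g z)"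

definition L2_norm :: "(real \<times> real \<Rightarrow> 'a::euclidean_space) \<Rightarrow> real" where
  "L2_norm f = sqrt (L2_inner f f)"

definition partial_x :: "(real \<times> real \<Rightarrow> real) \<Rightarrow> real \<times> real \<Rightarrow> real" where
  "partial_x w z = deriv (\<lambda>x. w (x, snd z)) (fst z)"

definition partial_y :: "(real \<times> real \<Rightarrow> real) \<Rightarrow> real \<times> real \<Rightarrow> real" where
  "partial_y w z = deriv (\<lambda>y. w (fst z, y)) (snd z)"

definition grad :: "(real \<times> real \<Rightarrow> real) \<Rightarrow> real \<times> real \<Rightarrow> real \<times> real" where
  "grad w z = (partial_x w z, partial_y w z)"

primrec C_k :: "nat \<Rightarrow> (real \<times> real \<Rightarrow> real) \<Rightarrow> bool" where
  "C_k 0 w \<longleftrightarrow> continuous_on UNIV w"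
| "C_k (Suc k) w \<longleftrightarrow>
     (\<forall>z. w differentiable (at z)) \<and> C_k k (partial_x w) \<and> C_k k (partial_y w)"

definition test_functions :: "(real \<times> real \<Rightarrow> real) set" where
  "test_functions =
     {\<phi>. (\<forall>k. C_k k \<phi>) \<and> compact (closure {z. \<phi> z \<noteq> 0}) \<and> closure {z. \<phi> z \<noteq> 0} \<subseteq> \<Omega>}"

definition weak_gradient ::
    "(real \<times> real \<Rightarrow> real) \<Rightarrow> (real \<times> real \<Rightarrow> real \<times> real) \<Rightarrow> bool" where
  "weak_gradient w G \<longleftrightarrow>
     (\<forall>\<phi>\<in>test_functions.
        L2_inner w (partial_x \<phi>) = - L2_inner (\<lambda>z. fst (G z)) \<phi> \<and>
        L2_inner w (partial_y \<phi>) = - L2_inner (\<lambda>z. snd (G z)) \<phi>)"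

text \<open>The closure of the test functions in the norm of $H^1(\Omega)$.\<close>

definition H1_0 :: "(real \<times> real \<Rightarrow> real) set" where
  "H1_0 =
     {w \<in> L2. \<exists>G\<in>L2. weak_gradient w G \<and>
        (\<forall>\<epsilon>>0. \<exists>\<phi>\<in>test_functions.
           sqrt ((L2_norm (\<lambda>z. w z - \<phi> z))\<^sup>2 + (L2_norm (\<lambda>z. G z - grad \<phi> z))\<^sup>2) < \<epsilon>)}"

definition poly_tensor :: "nat \<Rightarrow> (real \<times> real \<Rightarrow> real) set" where
  "poly_tensor N =
     {w. \<exists>m (r :: nat \<Rightarrow> real poly) (s :: nat \<Rightarrow> real poly).
        (\<forall>i<m. degree (r i) \<le> N \<and> degree (s i) \<le> N) \<and>
        (\<forall>(x, y)\<in>\<Omega>. w (x, y) = (\<Sum>i<m. poly (r i) x * poly (s i) y))}"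

definition V0 :: "nat \<Rightarrow> (real \<times> real \<Rightarrow> real) set" where
  "V0 N = poly_tensor N \<inter> H1_0"

definition RL_integral :: "real \<Rightarrow> (real \<Rightarrow> real) \<Rightarrow> real \<Rightarrow> real" where
  "RL_integral \<gamma> w t = 1 / Gamma \<gamma> * (LINT s:{0..t}|lebesgue. (t - s) powr (\<gamma> - 1) * w s)"

definition on_grid :: "real \<Rightarrow> (real \<times> real \<Rightarrow> real \<Rightarrow> real) \<Rightarrow> nat \<Rightarrow> real \<times> real \<Rightarrow> real" where
  "on_grid \<tau> w n z = w z (real n * \<tau>)"

text \<open>
  Below, the index \<open>k\<close> of \<open>diff_mid\<close>, \<open>mean_mid\<close> and \<open>frac_mid\<close> stands for the
  half-integer time level $k + \frac12$.
\<close>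

definition diff_mid ::
    "real \<Rightarrow> (nat \<Rightarrow> real \<times> real \<Rightarrow> 'a::real_vector) \<Rightarrow> nat \<Rightarrow> real \<times> real \<Rightarrow> 'a" where
  "diff_mid \<tau> w k z = (w (k + 1) z - w k z) /\<^sub>R \<tau>"

definition mean_mid ::
    "(nat \<Rightarrow> real \<times> real \<Rightarrow> 'a::real_vector) \<Rightarrow> nat \<Rightarrow> real \<times> real \<Rightarrow> 'a" where
  "mean_mid w k z = (w (k + 1) z + w k z) /\<^sub>R 2"

definition g_coeff :: "real \<Rightarrow> nat \<Rightarrow> real" where
  "g_coeff \<gamma> j = (-1) ^ j * (\<gamma> gchoose j)"

primrec lambda_coeff :: "real \<Rightarrow> nat \<Rightarrow> real" where
  "lambda_coeff \<gamma> 0 = (1 + \<gamma> / 2) * g_coeff \<gamma> 0"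
| "lambda_coeff \<gamma> (Suc j) = (1 + \<gamma> / 2) * g_coeff \<gamma> (Suc j) - \<gamma> / 2 * g_coeff \<gamma> j"

definition frac_diff ::
    "real \<Rightarrow> real \<Rightarrow> (nat \<Rightarrow> real \<times> real \<Rightarrow> 'a::real_vector) \<Rightarrow> nat \<Rightarrow> real \<times> real \<Rightarrow> 'a" where
  "frac_diff \<tau> \<gamma> w n z = \<tau> powr (- \<gamma>) *\<^sub>R (\<Sum>j=0..n. lambda_coeff \<gamma> j *\<^sub>R w (n - j) z)"

definition frac_mid ::
    "real \<Rightarrow> real \<Rightarrow> (nat \<Rightarrow> real \<times> real \<Rightarrow> 'a::real_vector) \<Rightarrow> nat \<Rightarrow> real \<times> real \<Rightarrow> 'a" where
  "frac_mid \<tau> \<gamma> w = mean_mid (frac_diff \<tau> \<gamma> w)"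

end

theory Submission
  imports Defs
begin

text \<open>
  The theorem is an energy estimate. Using both \<open>u (k + 1)\<close> and \<open>u k\<close> as test function in
  the \<open>k\<close>-th equation and adding the results amounts to testing with twice the average of the
  two. The difference quotient and the splitting term $\frac{q^2}{p^2}(\ldots)$ then
  become differences of squared norms, which telescope when the equations are summed over \<open>k\<close>.

  The terms with memory need a sign. Because the initial value vanishes,
  $D_\tau^{\gamma,k+\frac12}w$ is, up to the factor $\tau^{-\gamma}$, the convolution of the weights
  $\lambda^{(\gamma)}$ with the averages $v_k = w^{k+\frac12}$ (lemma
  \<open>frac_mid_eq_mean_mid_convolution\<close>), so after summation each of these terms is a positive multiple
  of an integral over $\Omega$ of a quadratic form
  \[ \sum_{k<n}\sum_{j\le k}\lambda_j^{(\gamma)}\,v_{k-j}\,v_k . \]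
  Such a form is the mean over the unit circle of
  $\mathrm{Re}\,\Lambda(\zeta)\,|V(\zeta)|^2$, where $\Lambda$ is the generating function of the
  weights and $V(\zeta)=\sum_k v_k\zeta^k$; it is nonnegative as soon as
  $\mathrm{Re}\,\Lambda\ge0$. Here
  $\Lambda(\zeta)=\bigl(1+\frac{\gamma}{2}(1-\zeta)\bigr)(1-\zeta)^{\gamma}$, and its real part is
  nonnegative in the open unit disc for every $|\gamma|\le1$ (lemma
  \<open>Re_powr_times_linear_nonneg\<close>). All the orders that occur, $\beta_i$ and $-\beta$, lie in
  $[-1,1]$. The singularity of $\Lambda$ at $\zeta=1$ is avoided by damping the weights with
  $r^j$ and letting $r$ tend to $1$ (lemma \<open>lambda_coeff_convolution_nonneg\<close>).

  Dropping all nonnegative terms and using Young's inequality on the right-hand side leaves, with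
  $E_n=\|u^n\|^2$,
  \[ E_n \le \tau\sum_{k<n}\|g^{k+\frac12}\|^2 + \tau\sum_{k<n}E_k + \frac{\tau}{2}E_n . \]
  For $\tau<1$ the last term is absorbed at the price of a factor $2$, and the discrete Gronwall
  inequality gives $\exp(2\tau n)\le\exp(2T)$.
\<close>

section \<open>Positivity of the convolution with the weights\<close>

text \<open>
  For $w=\rho e^{i\varphi}$ in the disc $|1-w|<1$, $|\varphi|<\pi/2$ and $\rho<2\cos\varphi$. Since
  $|\gamma|\le1$, the angle $\gamma\varphi$ is no further from $0$ than $\varphi$, so
  $\cos\gamma\varphi\ge\cos\varphi$ and
  $\gamma\sin\gamma\varphi\,\sin\varphi\le|\gamma|\sin^2\varphi$. These two bounds reduce the claim to
  $\cos\varphi-|\gamma|\rho/2\ge0$, which is where $\rho<2\cos\varphi$ enters.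
\<close>

lemma Re_powr_times_linear_nonneg:
  fixes w :: complex and \<gamma> :: real
  assumes \<gamma>: "\<bar>\<gamma>\<bar> \<le> 1" and w: "cmod (1 - w) < 1"
  shows "0 \<le> Re ((1 + of_real (\<gamma> / 2) * w) * w powr of_real \<gamma>)"
proof -
  define \<rho> \<phi> where "\<rho> = cmod w" and "\<phi> = Arg w"
  have w0: "w \<noteq> 0" using w by auto
  have w_eq: "w = of_real \<rho> * cis \<phi>"
    using w0 by (simp add: \<rho>_def \<phi>_def complex_norm_eq_1_exp_eq rcis_cmod_Arg flip: rcis_def)
  have rho: "\<rho> > 0" using w0 by (simp add: \<rho>_def)
  have "(cmod (1 - w))\<^sup>2 < 1" using w by (simp add: power_less_one_iff abs_square_less_1)
  then have "\<rho>\<^sup>2 < 2 * Re w"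
    unfolding \<rho>_def cmod_power2 by (simp add: power2_eq_square algebra_simps)
  then have "\<rho> * \<rho> < \<rho> * (2 * cos \<phi>)"
    by (simp add: w_eq power2_eq_square mult_ac)
  then have rho_less: "\<rho> < 2 * cos \<phi>" using rho by simp
  then have cos_pos: "cos \<phi> > 0" using rho by linarith
  then have "Re w > 0" using rho by (simp add: w_eq)
  then have phi: "\<bar>\<phi>\<bar> < pi / 2" unfolding \<phi>_def using Re_Ln_pos_lt w0 Arg_eq_Im_Ln by auto
  have le: "\<bar>\<gamma> * \<phi>\<bar> \<le> \<bar>\<phi>\<bar>" using \<gamma> by (simp add: abs_mult mult_left_le_one_le)
  have cos_le: "cos \<phi> \<le> cos (\<gamma> * \<phi>)"
    using cos_monotone_0_pi_le[OF _ le] phi by (simp add: cos_abs_real)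
  have sin_le: "\<gamma> * (sin (\<gamma> * \<phi>) * sin \<phi>) \<le> \<bar>\<gamma>\<bar> * (sin \<phi>)\<^sup>2"
  proof -
    have abs_sin: "\<bar>sin x\<bar> = sin \<bar>x\<bar>" if "\<bar>x\<bar> \<le> pi" for x :: real
      using that sin_ge_zero[of "\<bar>x\<bar>"] by (cases "x \<ge> 0") auto
    have "\<bar>\<phi>\<bar> \<le> pi" "\<bar>\<gamma> * \<phi>\<bar> \<le> pi" using le phi by linarith+
    then have "\<bar>sin (\<gamma> * \<phi>)\<bar> = sin \<bar>\<gamma> * \<phi>\<bar>" "\<bar>sin \<phi>\<bar> = sin \<bar>\<phi>\<bar>"
      by (simp_all only: abs_sin)
    moreover have "sin \<bar>\<gamma> * \<phi>\<bar> \<le> sin \<bar>\<phi>\<bar>"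
      using le phi by (intro sin_monotone_2pi_le) auto
    ultimately have "\<bar>sin (\<gamma> * \<phi>)\<bar> * \<bar>sin \<phi>\<bar> \<le> \<bar>sin \<phi>\<bar> * \<bar>sin \<phi>\<bar>"
      by (intro mult_right_mono) auto
    then have "\<bar>\<gamma>\<bar> * (\<bar>sin (\<gamma> * \<phi>)\<bar> * \<bar>sin \<phi>\<bar>) \<le> \<bar>\<gamma>\<bar> * (\<bar>sin \<phi>\<bar> * \<bar>sin \<phi>\<bar>)"
      by (intro mult_left_mono) auto
    moreover have "\<gamma> * (sin (\<gamma> * \<phi>) * sin \<phi>) \<le> \<bar>\<gamma>\<bar> * (\<bar>sin (\<gamma> * \<phi>)\<bar> * \<bar>sin \<phi>\<bar>)"
      by (metis abs_ge_self abs_mult)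
    ultimately show ?thesis by (simp add: power2_eq_square)
  qed
  have b: "\<bar>\<gamma>\<bar> * (\<rho> / 2) \<le> cos \<phi>"
  proof -
    have "\<bar>\<gamma>\<bar> * (\<rho> / 2) \<le> \<rho> / 2" using \<gamma> rho by (intro mult_left_le_one_le) auto
    then show ?thesis using rho_less by linarith
  qed
  have gb: "- (\<bar>\<gamma>\<bar> * (\<rho> / 2)) * cos \<phi> \<le> \<gamma> * (\<rho> / 2) * cos \<phi>"
    using cos_pos rho by (intro mult_right_mono) (auto simp: abs_if)
  have "\<bar>\<gamma>\<bar> * (\<rho> / 2) * cos \<phi> \<le> 1 * 1"
    using b cos_pos rho order.trans[OF b cos_le_one[of \<phi>]] by (intro mult_mono) auto
  then have "- 1 \<le> - (\<bar>\<gamma>\<bar> * (\<rho> / 2)) * cos \<phi>" by simp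
  from order.trans[OF this gb] have n1: "0 \<le> 1 + \<gamma> * (\<rho> / 2) * cos \<phi>" by simp
  have "0 \<le> cos \<phi> - \<bar>\<gamma>\<bar> * (\<rho> / 2)" using b by simp
  also have "\<dots> = cos \<phi> * (1 + - (\<bar>\<gamma>\<bar> * (\<rho> / 2)) * cos \<phi>) - (\<rho> / 2) * (\<bar>\<gamma>\<bar> * (sin \<phi>)\<^sup>2)"
    unfolding sin_squared_eq by (simp add: algebra_simps power2_eq_square)
  also have "\<dots> \<le> cos \<phi> * (1 + \<gamma> * (\<rho> / 2) * cos \<phi>) - (\<rho> / 2) * (\<gamma> * (sin (\<gamma> * \<phi>) * sin \<phi>))"
    using gb sin_le cos_pos rho by (intro diff_mono mult_left_mono add_left_mono) auto
  also have "\<dots> \<le> cos (\<gamma> * \<phi>) * (1 + \<gamma> * (\<rho> / 2) * cos \<phi>) - (\<rho> / 2) * (\<gamma> * (sin (\<gamma> * \<phi>) * sin \<phi>))"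
    using cos_le n1 by (intro diff_right_mono mult_right_mono) auto
  finally have main: "0 \<le> \<dots>" .
  have "w powr of_real \<gamma> = of_real (\<rho> powr \<gamma>) * cis (\<gamma> * \<phi>)"
  proof -
    have "Ln w = of_real (ln \<rho>) + \<i> * of_real \<phi>"
      using w0 by (simp add: \<rho>_def \<phi>_def complex_eq_iff Arg_eq_Im_Ln)
    then show ?thesis using w0 rho
      by (simp add: powr_def exp_add ring_distribs cis_conv_exp mult_ac flip: exp_of_real)
  qed
  then have "Re ((1 + of_real (\<gamma> / 2) * w) * w powr of_real \<gamma>) = \<rho> powr \<gamma> *
      (cos (\<gamma> * \<phi>) * (1 + \<gamma> * (\<rho> / 2) * cos \<phi>) - (\<rho> / 2) * (\<gamma> * (sin (\<gamma> * \<phi>) * sin \<phi>)))"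
    by (simp add: w_eq algebra_simps add_divide_distrib diff_divide_distrib)
  then show ?thesis using main by simp
qed

lemma has_integral_cos_int_period:
  fixes m :: int
  shows "((\<lambda>t. cos (of_int m * t)) has_integral (if m = 0 then 2 * pi else 0)) {0..2 * pi}"
proof (cases "m = 0")
  case True
  then show ?thesis using has_integral_const_real[of "1::real" 0 "2 * pi"] by simp
next
  case False
  have "((\<lambda>t. cos (of_int m * t)) has_integral
      (sin (of_int m * (2 * pi)) / of_int m - sin (of_int m * 0) / of_int m)) {0..2 * pi}"
    using False by (intro fundamental_theorem_of_calculus)
      (auto intro!: derivative_eq_intros simp flip: has_real_derivative_iff_has_vector_derivative)
  moreover have "sin (of_int m * (2 * pi)) = 0"
    using sin_int_2pin[of m] by (simp add: mult_ac)
  ultimately show ?thesis using False by simp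
qed

text \<open>
  By orthogonality of the characters $e^{imt}$, the quadratic form is the mean over the circle of
  $\mathrm{Re}\,P\,|V|^2$, where $P$ and $V$ are the trigonometric polynomials with coefficients
  \<open>c\<close> and \<open>v\<close>. Letting \<open>J\<close> exceed \<open>n\<close> allows $P$ to be a long partial sum of a power
  series the real part of whose limit is known.
\<close>

lemma convolution_form_nonneg_if_Re_nonneg:
  fixes c v :: "nat \<Rightarrow> real"
  assumes Re: "\<And>t. 0 \<le> Re (\<Sum>j<J. of_real (c j) * cis t ^ j)" and J: "n \<le> J"
  shows "0 \<le> (\<Sum>k<n. \<Sum>j\<le>k. c j * v (k - j) * v k)"
proof -
  define V where "V t = (\<Sum>k<n. of_real (v k) * cis t ^ k)" for t
  define h where "h t = (\<Sum>l<n. \<Sum>k<n. \<Sum>j<J. c j * v k * v l * cos (of_int (int j + int k - int l) * t))" for t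
  have h: "h t = Re (\<Sum>j<J. of_real (c j) * cis t ^ j) * (cmod (V t))\<^sup>2" for t
  proof -
    have "Re (\<Sum>j<J. of_real (c j) * cis t ^ j) * (cmod (V t))\<^sup>2
        = Re ((\<Sum>j<J. of_real (c j) * cis t ^ j) * of_real ((cmod (V t))\<^sup>2))"
      by simp
    also have "\<dots> = Re ((\<Sum>j<J. of_real (c j) * cis t ^ j) * (V t * cnj (V t)))"
      by (simp only: complex_norm_square)
    also have "\<dots> = Re (cnj (V t) * (V t * (\<Sum>j<J. of_real (c j) * cis t ^ j)))"
      by (simp add: mult_ac)
    also have "V t * (\<Sum>j<J. of_real (c j) * cis t ^ j)
        = (\<Sum>k<n. \<Sum>j<J. of_real (v k) * cis t ^ k * (of_real (c j) * cis t ^ j))"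
      by (simp only: V_def sum_product)
    also have "cnj (V t) * \<dots> = (\<Sum>l<n. of_real (v l) * cnj (cis t ^ l) * \<dots>)"
      by (simp add: V_def sum_distrib_right)
    also have "\<dots> = (\<Sum>l<n. \<Sum>k<n. \<Sum>j<J. of_real (v l) * cnj (cis t ^ l) *
         (of_real (v k) * cis t ^ k * (of_real (c j) * cis t ^ j)))"
      by (simp only: sum_distrib_left)
    also have "Re \<dots> = h t"
      unfolding h_def Re_sum
    proof (intro sum.cong refl)
      fix l k j
      have "cnj (cis t ^ l) * (cis t ^ k * cis t ^ j) = cis (of_int (int j + int k - int l) * t)"
        by (simp only: Complex.DeMoivre complex_cnj_power cis_cnj cis_mult)
          (rule arg_cong[where f = cis], simp add: algebra_simps)
      then have "of_real (v l) * cnj (cis t ^ l) * (of_real (v k) * cis t ^ k * (of_real (c j) * cis t ^ j))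
        = of_real (c j * v k * v l) * cis (of_int (int j + int k - int l) * t)"
        by (metis (no_types, opaque_lifting) mult.assoc mult.commute of_real_mult)
      then show "Re (of_real (v l) * cnj (cis t ^ l) * (of_real (v k) * cis t ^ k * (of_real (c j) * cis t ^ j)))
        = c j * v k * v l * cos (of_int (int j + int k - int l) * t)"
        by (simp only: times_complex.sel Re_complex_of_real Im_complex_of_real cis.sel mult_zero_left diff_zero)
    qed
    finally show ?thesis by simp
  qed
  have "(h has_integral (\<Sum>l<n. \<Sum>k<n. \<Sum>j<J. c j * v k * v l *
      (if int j + int k - int l = 0 then 2 * pi else 0))) {0..2 * pi}"
    unfolding h_def
    by (intro has_integral_sum has_integral_mult_right has_integral_cos_int_period) auto
  then have "0 \<le> (\<Sum>l<n. \<Sum>k<n. \<Sum>j<J. c j * v k * v l *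
      (if int j + int k - int l = 0 then 2 * pi else 0))"
    by (rule has_integral_nonneg) (simp only: h mult_nonneg_nonneg Re zero_le_power2)
  also have "\<dots> = (\<Sum>l<n. \<Sum>j<J. \<Sum>k<n. c j * v k * v l *
      (if int j + int k - int l = 0 then 2 * pi else 0))"
    by (intro sum.cong refl sum.swap)
  also have "\<dots> = (\<Sum>l<n. 2 * pi * (\<Sum>j\<le>l. c j * v (l - j) * v l))"
  proof (intro sum.cong refl)
    fix l assume l: "l \<in> {..<n}"
    have "(\<Sum>j<J. \<Sum>k<n. c j * v k * v l * (if int j + int k - int l = 0 then 2 * pi else 0))
       = (\<Sum>j<J. if j \<le> l then 2 * pi * (c j * v (l - j) * v l) else 0)"
    proof (intro sum.cong refl)
      fix j
      have "(\<Sum>k<n. c j * v k * v l * (if int j + int k - int l = 0 then 2 * pi else 0))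
        = (\<Sum>k<n. if k = l - j then (if j \<le> l then 2 * pi * (c j * v (l - j) * v l) else 0) else 0)"
        by (intro sum.cong refl) auto
      also have "\<dots> = (if j \<le> l then 2 * pi * (c j * v (l - j) * v l) else 0)"
        using l by (subst sum.delta) auto
      finally show "(\<Sum>k<n. c j * v k * v l * (if int j + int k - int l = 0 then 2 * pi else 0))
        = (if j \<le> l then 2 * pi * (c j * v (l - j) * v l) else 0)" .
    qed
    also have "\<dots> = (\<Sum>j\<in>{j\<in>{..<J}. j \<le> l}. 2 * pi * (c j * v (l - j) * v l))"
      by (rule sum.inter_filter[symmetric]) simp
    also have "{j\<in>{..<J}. j \<le> l} = {..l}" using l J by auto
    finally show "(\<Sum>j<J. \<Sum>k<n. c j * v k * v l * (if int j + int k - int l = 0 then 2 * pi else 0))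
      = 2 * pi * (\<Sum>j\<le>l. c j * v (l - j) * v l)" by (simp add: sum_distrib_left)
  qed
  also have "\<dots> = 2 * pi * (\<Sum>l<n. \<Sum>j\<le>l. c j * v (l - j) * v l)"
    by (simp add: sum_distrib_left)
  finally show ?thesis by (simp add: zero_le_mult_iff not_le[THEN iffD2, OF pi_gt_zero])
qed

text \<open>
  The generating function of the weights: the binomial series of $(1-z)^\gamma$ multiplied by the
  linear factor $1+\frac{\gamma}{2}(1-z)$, whose two coefficients are those in the definition of
  the weights.
\<close>

lemma lambda_coeff_sums:
  fixes z :: complex
  assumes z: "cmod z < 1"
  shows "(\<lambda>j. of_real (lambda_coeff \<gamma> j) * z ^ j) sums
    ((1 + of_real (\<gamma> / 2) * (1 - z)) * (1 - z) powr of_real \<gamma>)"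
proof -
  define G where "G = (1 - z) powr of_real \<gamma>"
  have g: "(\<lambda>j. of_real (g_coeff \<gamma> j) * z ^ j) sums G"
  proof -
    have "(\<lambda>j. (of_real \<gamma> gchoose j) * (- z) ^ j) sums (1 + - z) powr of_real \<gamma>"
      by (rule gen_binomial_complex) (use z in simp)
    moreover have "of_real (g_coeff \<gamma> j) * z ^ j = (of_real \<gamma> gchoose j) * (- z) ^ j" for j
      by (subst power_minus) (simp add: g_coeff_def gbinomial_prod_rev mult_ac)
    ultimately show ?thesis by (simp add: G_def)
  qed
  have "(\<lambda>j. of_real (g_coeff \<gamma> (Suc j)) * z ^ Suc j) sums (G - of_real (g_coeff \<gamma> 0))"
    using g sums_Suc_iff[of "\<lambda>j. of_real (g_coeff \<gamma> j) * z ^ j"] by simp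
  then have "(\<lambda>j. of_real (1 + \<gamma> / 2) * (of_real (g_coeff \<gamma> (Suc j)) * z ^ Suc j)
        - of_real (\<gamma> / 2) * z * (of_real (g_coeff \<gamma> j) * z ^ j))
      sums (of_real (1 + \<gamma> / 2) * (G - of_real (g_coeff \<gamma> 0)) - of_real (\<gamma> / 2) * z * G)"
    using g by (intro sums_diff sums_mult)
  then have "(\<lambda>j. of_real (lambda_coeff \<gamma> (Suc j)) * z ^ Suc j) sums
      (of_real (1 + \<gamma> / 2) * (G - of_real (g_coeff \<gamma> 0)) - of_real (\<gamma> / 2) * z * G)"
    by (simp add: algebra_simps)
  then have "(\<lambda>j. of_real (lambda_coeff \<gamma> j) * z ^ j) sums
      (of_real (1 + \<gamma> / 2) * (G - of_real (g_coeff \<gamma> 0)) - of_real (\<gamma> / 2) * z * G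
        + of_real (lambda_coeff \<gamma> 0) * z ^ 0)"
    by (subst (asm) sums_Suc_iff) (simp add: algebra_simps)
  moreover have "of_real (1 + \<gamma> / 2) * (G - of_real (g_coeff \<gamma> 0)) - of_real (\<gamma> / 2) * z * G
      + of_real (lambda_coeff \<gamma> 0) * z ^ 0 = (1 + of_real (\<gamma> / 2) * (1 - z)) * G"
    by (simp add: algebra_simps add_divide_distrib diff_divide_distrib)
  ultimately show ?thesis by (simp only: G_def)
qed

text \<open>
  On the circle of radius $r<1$ the generating function is approximated uniformly by its partial
  sums, so a long partial sum has real part at least $-\epsilon$ there. Adding $\epsilon$ to the
  constant coefficient makes it admissible in
  \<open>convolution_form_nonneg_if_Re_nonneg\<close>, at the cost of $\epsilon\sum_k v_k^2$. This gives the claim for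
  the weights damped by $r^j$; the form is a polynomial in $r$, hence continuous at $r=1$.
\<close>

lemma lambda_coeff_convolution_nonneg:
  fixes v :: "nat \<Rightarrow> real"
  assumes \<gamma>: "\<bar>\<gamma>\<bar> \<le> 1"
  shows "0 \<le> (\<Sum>k<n. \<Sum>j\<le>k. lambda_coeff \<gamma> j * v (k - j) * v k)"
proof -
  define S where "S r = (\<Sum>k<n. \<Sum>j\<le>k. lambda_coeff \<gamma> j * r ^ j * v (k - j) * v k)" for r
  have damped: "0 \<le> S r" if r: "0 < r" "r < 1" for r
  proof (rule field_le_epsilon)
    fix e :: real assume e: "e > 0"
    define \<epsilon> where "\<epsilon> = e / (1 + (\<Sum>k<n. (v k)\<^sup>2))"
    have pos: "1 + (\<Sum>k<n. (v k)\<^sup>2) > 0" by (intro add_pos_nonneg sum_nonneg) auto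
    then have eps: "\<epsilon> > 0" using e by (simp add: \<epsilon>_def)
    define b where "b j = \<bar>lambda_coeff \<gamma> j\<bar> * r ^ j" for j
    have "summable b"
    proof -
      obtain s where s: "r < s" "s < 1" using r dense by blast
      have "summable (\<lambda>j. of_real (lambda_coeff \<gamma> j) * (of_real s :: complex) ^ j)"
        using lambda_coeff_sums[of "of_real s" \<gamma>] s r by (auto simp: sums_iff)
      then have "summable (\<lambda>j. norm (of_real (lambda_coeff \<gamma> j) * (of_real r :: complex) ^ j))"
        by (rule powser_insidea) (use r s in auto)
      then show ?thesis using r by (simp add: b_def[abs_def] norm_mult norm_power)
    qed
    from suminf_exist_split[OF eps this] obtain J0 where
      J0: "\<And>m. m \<ge> J0 \<Longrightarrow> norm (\<Sum>i. b (i + m)) < \<epsilon>" by blast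
    (* J > 0, so that the partial sum contains the constant coefficient. *)
    define J where "J = max (Suc n) J0"
    have tail: "(\<Sum>i. b (i + J)) < \<epsilon>" using J0[of J] by (auto simp: J_def)
    define c where "c j = lambda_coeff \<gamma> j * r ^ j + (if j = 0 then \<epsilon> else 0)" for j
    have "0 \<le> (\<Sum>k<n. \<Sum>j\<le>k. c j * v (k - j) * v k)"
    proof (rule convolution_form_nonneg_if_Re_nonneg)
      show "n \<le> J" by (simp add: J_def)
      fix t
      define z where "z = of_real r * cis t"
      define F where "F j = of_real (lambda_coeff \<gamma> j) * z ^ j" for j
      have z: "cmod z < 1" using r by (simp add: z_def norm_mult)
      have Fs: "F sums ((1 + of_real (\<gamma> / 2) * (1 - z)) * (1 - z) powr of_real \<gamma>)"
        unfolding F_def by (rule lambda_coeff_sums[OF z])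
      have b: "norm (F j) = b j" for j
        using r by (simp add: F_def b_def z_def norm_mult norm_power)
      have "0 \<le> Re (suminf F)"
        using Re_powr_times_linear_nonneg[OF \<gamma>, of "1 - z"] z Fs by (simp add: sums_iff)
      also have "suminf F = (\<Sum>i. F (i + J)) + sum F {..<J}"
        using Fs by (intro suminf_split_initial_segment) (simp add: sums_iff)
      also have "Re \<dots> \<le> \<epsilon> + Re (sum F {..<J})"
      proof -
        have "norm (\<Sum>i. F (i + J)) \<le> (\<Sum>i. norm (F (i + J)))"
          using \<open>summable b\<close> by (intro summable_norm) (simp add: b summable_iff_shift)
        then show ?thesis using tail complex_Re_le_cmod[of "\<Sum>i. F (i + J)"] by (simp add: b)
      qed
      also have "\<dots> = Re (\<Sum>j<J. of_real (c j) * cis t ^ j)"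
      proof -
        have "(\<Sum>j<J. of_real (c j) * cis t ^ j)
            = (\<Sum>j<J. F j + (if j = 0 then of_real \<epsilon> else 0))"
          by (intro sum.cong refl) (auto simp: c_def F_def z_def algebra_simps power_mult_distrib)
        also have "\<dots> = sum F {..<J} + of_real \<epsilon>"
          by (simp add: sum.distrib J_def)
        finally show ?thesis by simp
      qed
      finally show "0 \<le> Re (\<Sum>j<J. of_real (c j) * cis t ^ j)" .
    qed
    also have "(\<Sum>k<n. \<Sum>j\<le>k. c j * v (k - j) * v k) = S r + \<epsilon> * (\<Sum>k<n. (v k)\<^sup>2)"
    proof -
      have "(\<Sum>j\<le>k. c j * v (k - j) * v k)
          = (\<Sum>j\<le>k. lambda_coeff \<gamma> j * r ^ j * v (k - j) * v k) + \<epsilon> * (v k)\<^sup>2" for k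
      proof -
        have "(\<Sum>j\<le>k. c j * v (k - j) * v k) = (\<Sum>j\<le>k. lambda_coeff \<gamma> j * r ^ j * v (k - j) * v k
          + (if j = 0 then \<epsilon> * (v k)\<^sup>2 else 0))"
          by (intro sum.cong refl) (auto simp: c_def algebra_simps power2_eq_square)
        then show ?thesis by (simp add: sum.distrib)
      qed
      then show ?thesis by (simp add: S_def sum.distrib sum_distrib_left)
    qed
    also have "\<dots> \<le> S r + e"
      using e pos by (simp add: \<epsilon>_def field_simps) 
    finally show "0 \<le> S r + e" .
  qed
  have "isCont S 1" unfolding S_def by (intro continuous_intros)
  then have "(S \<longlongrightarrow> S 1) (at_left 1)"
    by (simp add: isCont_def filterlim_at_split)
  moreover have "eventually (\<lambda>r. 0 \<le> S r) (at_left (1::real))"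
    using eventually_at_left_field[of _ "1::real"] damped by (metis zero_less_one)
  ultimately have "0 \<le> S 1"
    by (rule tendsto_lowerbound) simp
  then show ?thesis by (simp add: S_def)
qed

section \<open>Bilinear algebra in $L^2$\<close>

lemma L2_mult_integrable:
  fixes f h :: "real \<times> real \<Rightarrow> 'a::euclidean_space"
  assumes "f \<in> L2" "h \<in> L2"
  shows "integrable (lebesgue_on \<Omega>) (\<lambda>z. f z \<bullet> h z)"
proof (rule Bochner_Integration.integrable_bound)
  show "integrable (lebesgue_on \<Omega>) (\<lambda>z. (norm (f z))\<^sup>2 + (norm (h z))\<^sup>2)"
    using assms by (auto simp: L2_def)
  show "(\<lambda>z. f z \<bullet> h z) \<in> borel_measurable (lebesgue_on \<Omega>)"
    using assms by (auto simp: L2_def)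
  have "\<bar>x \<bullet> y\<bar> \<le> (norm x)\<^sup>2 + (norm y)\<^sup>2" for x y :: 'a
    using Cauchy_Schwarz_ineq2[of x y] sum_squares_bound[of "norm x" "norm y"]
      mult_nonneg_nonneg[of "norm x" "norm y"] by linarith
  then show "AE z in lebesgue_on \<Omega>. norm (f z \<bullet> h z) \<le> norm ((norm (f z))\<^sup>2 + (norm (h z))\<^sup>2)"
    by (intro AE_I2) (simp add: abs_of_nonneg)
qed

lemma L2_add:
  assumes "f \<in> L2" "h \<in> L2"
  shows "(\<lambda>z. f z + h z :: 'a::euclidean_space) \<in> L2"
proof -
  have "integrable (lebesgue_on \<Omega>) (\<lambda>z. (norm (f z))\<^sup>2 + 2 * (f z \<bullet> h z) + (norm (h z))\<^sup>2)"
    using assms L2_mult_integrable[OF assms] by (auto simp: L2_def)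
  then show ?thesis using assms
    by (auto simp: L2_def power2_norm_eq_inner inner_add inner_commute algebra_simps)
qed

lemma L2_scaleR:
  assumes "f \<in> L2" shows "(\<lambda>z. c *\<^sub>R f z :: 'a::euclidean_space) \<in> L2"
  using assms by (auto simp: L2_def power_mult_distrib)

lemma L2_scaleR_vector:
  assumes "f \<in> L2" shows "(\<lambda>z. f z *\<^sub>R (b :: 'a::euclidean_space)) \<in> L2"
  using assms by (auto simp: L2_def power_mult_distrib)

lemma L2_zero: "(\<lambda>z. 0 :: 'a::euclidean_space) \<in> L2"
  by (simp add: L2_def)

lemma L2_sum:
  assumes "\<And>i. i \<in> I \<Longrightarrow> f i \<in> L2"
  shows "(\<lambda>z. \<Sum>i\<in>I. f i z :: 'a::euclidean_space) \<in> L2"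
  using assms by (induction I rule: infinite_finite_induct) (auto intro: L2_zero L2_add)

lemma L2_inner_add_right:
  assumes "f \<in> L2" "h \<in> L2" "h' \<in> L2"
  shows "L2_inner f h + L2_inner f h' = L2_inner f (\<lambda>z. h z + h' z :: 'a::euclidean_space)"
  using assms unfolding L2_inner_def inner_add_right by (simp add: L2_mult_integrable)

lemma L2_inner_cong:
  assumes "\<And>z. z \<in> \<Omega> \<Longrightarrow> f z = f' z" "\<And>z. z \<in> \<Omega> \<Longrightarrow> h z = h' z"
  shows "L2_inner f h = L2_inner f' h'"
  unfolding L2_inner_def using assms by (intro Bochner_Integration.integral_cong) auto

lemma L2_inner_zero_right:
  assumes "\<And>z. z \<in> \<Omega> \<Longrightarrow> h z = 0"
  shows "L2_inner f h = 0"
  using L2_inner_cong[of f f h "\<lambda>_. 0"] assms by (simp add: L2_inner_def)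

lemma L2_norm_sq: "(L2_norm f)\<^sup>2 = L2_inner f f"
  unfolding L2_norm_def by (simp add: L2_inner_def)

lemma diff_mid_L2:
  assumes "w k \<in> L2" "w (k + 1) \<in> L2"
  shows "diff_mid \<tau> (w :: nat \<Rightarrow> _ \<Rightarrow> 'a::euclidean_space) k \<in> L2"
proof -
  have "(\<lambda>z. (1 / \<tau>) *\<^sub>R w (k + 1) z + (- 1 / \<tau>) *\<^sub>R w k z) \<in> L2"
    by (intro L2_add L2_scaleR assms)
  also have "(\<lambda>z. (1 / \<tau>) *\<^sub>R w (k + 1) z + (- 1 / \<tau>) *\<^sub>R w k z) = diff_mid \<tau> w k"
    by (auto simp: diff_mid_def divide_inverse scaleR_diff_right)
  finally show ?thesis .
qed

lemma mean_mid_L2: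
  assumes "w k \<in> L2" "w (k + 1) \<in> L2"
  shows "mean_mid (w :: nat \<Rightarrow> _ \<Rightarrow> 'a::euclidean_space) k \<in> L2"
  using L2_scaleR[OF L2_add[OF assms(2,1)], of "inverse 2"]
  by (simp add: mean_mid_def[abs_def])

lemma frac_mid_L2:
  fixes w :: "nat \<Rightarrow> real \<times> real \<Rightarrow> 'a::euclidean_space"
  assumes "\<And>j. j \<le> k + 1 \<Longrightarrow> w j \<in> L2"
  shows "frac_mid \<tau> \<gamma> w k \<in> L2"
proof -
  have "frac_diff \<tau> \<gamma> w n \<in> L2" if "n \<le> k + 1" for n
    unfolding frac_diff_def[abs_def] by (intro L2_scaleR L2_sum assms) (use that in auto)
  then show ?thesis unfolding frac_mid_def by (intro mean_mid_L2) auto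
qed

text \<open>
  The discrete counterpart of $2(\partial_t w,w)=\frac{d}{dt}\|w\|^2$: a difference quotient times
  a sum of the same two values is a difference of squares.
\<close>

lemma L2_inner_diff_mid:
  fixes w :: "nat \<Rightarrow> real \<times> real \<Rightarrow> 'a::euclidean_space"
  assumes w: "w k \<in> L2" "w (k + 1) \<in> L2"
  shows "L2_inner (diff_mid \<tau> w k) (w (k + 1)) + L2_inner (diff_mid \<tau> w k) (w k)
    = ((L2_norm (w (k + 1)))\<^sup>2 - (L2_norm (w k))\<^sup>2) / \<tau>"
proof -
  have "L2_inner (diff_mid \<tau> w k) (w (k + 1)) + L2_inner (diff_mid \<tau> w k) (w k)
     = (LINT z|lebesgue_on \<Omega>. ((w (k + 1) z \<bullet> w (k + 1) z) - (w k z \<bullet> w k z)) / \<tau>)"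
    unfolding L2_inner_add_right[OF diff_mid_L2[OF w] w(2,1)]
    by (simp add: L2_inner_def diff_mid_def inner_add inner_diff inner_commute divide_inverse algebra_simps)
  also have "\<dots> = ((L2_norm (w (k + 1)))\<^sup>2 - (L2_norm (w k))\<^sup>2) / \<tau>"
    unfolding L2_norm_sq L2_inner_def using L2_mult_integrable[OF w(1,1)] L2_mult_integrable[OF w(2,2)]
    by simp
  finally show ?thesis .
qed

text \<open>
  Young's inequality with these constants is what leaves $2\tau$ in front of the data and $2T$ in the
  exponent of the stability bound.
\<close>

lemma L2_young_mid:
  fixes h :: "real \<times> real \<Rightarrow> 'a::euclidean_space"
  assumes h: "h \<in> L2" and w: "w k \<in> L2" "w (k + 1) \<in> L2"
  shows "L2_inner h (w (k + 1)) + L2_inner h (w k)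
     \<le> (L2_norm h)\<^sup>2 + ((L2_norm (w (k + 1)))\<^sup>2 + (L2_norm (w k))\<^sup>2) / 2"
proof -
  have *: "x \<bullet> (y + y') \<le> x \<bullet> x + (y \<bullet> y + y' \<bullet> y') / 2" for x y y' :: 'a
  proof -
    have "0 \<le> (x - y) \<bullet> (x - y)" "0 \<le> (x - y') \<bullet> (x - y')" by simp_all
    then show ?thesis by (simp add: inner_diff inner_add inner_commute field_simps)
  qed
  have "L2_inner h (w (k + 1)) + L2_inner h (w k) \<le>
      (LINT z|lebesgue_on \<Omega>. h z \<bullet> h z + (w (k + 1) z \<bullet> w (k + 1) z + w k z \<bullet> w k z) / 2)"
    unfolding L2_inner_add_right[OF h w(2,1)] unfolding L2_inner_def
    using L2_mult_integrable[OF w(1,1)] L2_mult_integrable[OF w(2,2)] L2_mult_integrable[OF h h]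
      L2_mult_integrable[OF h L2_add[OF w(2,1)]]
    by (intro integral_mono) (auto intro!: *)
  also have "\<dots> = (L2_norm h)\<^sup>2 + ((L2_norm (w (k + 1)))\<^sup>2 + (L2_norm (w k))\<^sup>2) / 2"
    unfolding L2_norm_sq L2_inner_def
    using L2_mult_integrable[OF w(1,1)] L2_mult_integrable[OF w(2,2)] L2_mult_integrable[OF h h]
    by simp
  finally show ?thesis .
qed

section \<open>Calculus of tensor-product polynomials on the square\<close>

lemma poly_tensorD:
  assumes "w \<in> poly_tensor N"
  obtains m r s where "\<And>i. i < m \<Longrightarrow> degree (r i) \<le> N" "\<And>i. i < m \<Longrightarrow> degree (s i) \<le> N"
    "\<And>x y. (x, y) \<in> \<Omega> \<Longrightarrow> w (x, y) = (\<Sum>i<(m::nat). poly (r i) x * poly (s i) y)"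
  using assms unfolding poly_tensor_def by blast

lemma poly_tensorI:
  assumes "\<And>i. i < m \<Longrightarrow> degree (r i) \<le> N" "\<And>i. i < m \<Longrightarrow> degree (s i) \<le> N"
    "\<And>x y. (x, y) \<in> \<Omega> \<Longrightarrow> w (x, y) = (\<Sum>i<(m::nat). poly (r i) x * poly (s i) y)"
  shows "w \<in> poly_tensor N"
  using assms unfolding poly_tensor_def by blast

lemma \<Omega>_lmeasurable: "\<Omega> \<in> lmeasurable"
proof -
  have "open \<Omega>" unfolding \<Omega>_def by (intro open_Times) auto
  moreover have "bounded \<Omega>" unfolding \<Omega>_def by (intro bounded_Times) auto
  ultimately show ?thesis
    by (intro bounded_set_imp_lmeasurable) (auto intro: borel_open sets_completionI_sets)
qed

lemma poly_tensor_L2: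
  assumes "w \<in> poly_tensor N" shows "w \<in> L2"
proof -
  obtain m r s where "\<And>i. i < m \<Longrightarrow> degree (r i) \<le> N" "\<And>i. i < m \<Longrightarrow> degree (s i) \<le> N"
    and w: "\<And>x y. (x, y) \<in> \<Omega> \<Longrightarrow> w (x, y) = (\<Sum>i<(m::nat). poly (r i) x * poly (s i) y)"
    by (rule poly_tensorD[OF assms]) (rule that)
  define P where "P z = (\<Sum>i<(m::nat). poly (r i) (fst z) * poly (s i) (snd z))" for z :: "real \<times> real"
  have P: "continuous_on A P" for A unfolding P_def by (intro continuous_intros)
  have "compact (P ` ({-1..1} \<times> {-1..1}))"
    by (intro compact_continuous_image P compact_Times) auto
  then obtain B where B: "\<And>z. z \<in> {-1..1} \<times> {-1..1} \<Longrightarrow> norm (P z) \<le> B"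
    using compact_imp_bounded bounded_iff by (metis imageI)
  have meas: "P \<in> borel_measurable (lebesgue_on \<Omega>)"
    using P continuous_imp_measurable_on_sets_lebesgue \<Omega>_lmeasurable by blast
  have "finite_measure (lebesgue_on \<Omega>)"
    using \<Omega>_lmeasurable by (rule finite_measure_lebesgue_on)
  then have "integrable (lebesgue_on \<Omega>) (\<lambda>z. (norm (P z))\<^sup>2)"
  proof (rule finite_measure.integrable_const_bound)
    show "AE z in lebesgue_on \<Omega>. norm ((norm (P z))\<^sup>2) \<le> B\<^sup>2"
    proof (rule AE_I2)
      fix z assume "z \<in> space (lebesgue_on \<Omega>)"
      then have "norm (P z) \<le> B" by (intro B) (auto simp: \<Omega>_def)
      then have "(norm (P z))\<^sup>2 \<le> B\<^sup>2" by (intro power_mono norm_ge_zero)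
      then show "norm ((norm (P z))\<^sup>2) \<le> B\<^sup>2" by simp
    qed
    show "(\<lambda>z. (norm (P z))\<^sup>2) \<in> borel_measurable (lebesgue_on \<Omega>)" using meas by simp
  qed
  moreover have eq: "w z = P z" if "z \<in> \<Omega>" for z
    using w[of "fst z" "snd z"] that by (simp add: P_def)
  ultimately have "integrable (lebesgue_on \<Omega>) (\<lambda>z. (norm (w z))\<^sup>2)"
    by (subst Bochner_Integration.integrable_cong[OF refl, of _ _ "\<lambda>z. (norm (P z))\<^sup>2"]) auto
  moreover have "w \<in> borel_measurable (lebesgue_on \<Omega>)"
    using meas eq by (subst measurable_cong[of _ _ P]) auto
  ultimately show ?thesis by (simp add: L2_def)
qed

text \<open>
  Only the values in the square are polynomial, but the square is open, so each slice agrees with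
  a polynomial near the point of differentiation.
\<close>

lemma poly_tensor_partial_x:
  assumes "w \<in> poly_tensor N"
  shows "z \<in> \<Omega> \<Longrightarrow> ((\<lambda>x. w (x, snd z)) has_real_derivative partial_x w z) (at (fst z))"
    and "partial_x w \<in> poly_tensor N"
proof -
  obtain m r s where deg: "\<And>i. i < m \<Longrightarrow> degree (r i) \<le> N" "\<And>i. i < m \<Longrightarrow> degree (s i) \<le> N"
    and w: "\<And>x y. (x, y) \<in> \<Omega> \<Longrightarrow> w (x, y) = (\<Sum>i<(m::nat). poly (r i) x * poly (s i) y)"
    by (rule poly_tensorD[OF assms]) (rule that)
  have D: "((\<lambda>x. w (x, y)) has_real_derivative (\<Sum>i<m. poly (pderiv (r i)) x * poly (s i) y)) (at x)"
    if "(x, y) \<in> \<Omega>" for x y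
  proof (rule DERIV_cong_ev[THEN iffD2, OF refl _ refl])
    have "eventually (\<lambda>x. x \<in> {-1<..<1}) (nhds x)"
      using that by (intro eventually_nhds_in_open) (auto simp: \<Omega>_def)
    then show "\<forall>\<^sub>F x in nhds x. w (x, y) = (\<Sum>i<m. poly (r i) x * poly (s i) y)"
      by eventually_elim (use that w in \<open>auto simp: \<Omega>_def\<close>)
    show "((\<lambda>x. \<Sum>i<m. poly (r i) x * poly (s i) y) has_real_derivative
        (\<Sum>i<m. poly (pderiv (r i)) x * poly (s i) y)) (at x)"
      by (intro DERIV_sum DERIV_cmult_right poly_DERIV)
  qed
  have eq: "partial_x w (x, y) = (\<Sum>i<m. poly (pderiv (r i)) x * poly (s i) y)"
    if "(x, y) \<in> \<Omega>" for x y
    using D[OF that] by (simp add: partial_x_def DERIV_imp_deriv)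
  show "((\<lambda>x. w (x, snd z)) has_real_derivative partial_x w z) (at (fst z))" if "z \<in> \<Omega>"
    using D[of "fst z" "snd z"] eq[of "fst z" "snd z"] that by simp
  show "partial_x w \<in> poly_tensor N"
    by (rule poly_tensorI[of m "\<lambda>i. pderiv (r i)" N s, OF _ deg(2) eq])
      (use deg(1) in \<open>auto simp: degree_pderiv intro: diff_le_self order.trans\<close>)
qed

lemma poly_tensor_partial_y:
  assumes "w \<in> poly_tensor N"
  shows "z \<in> \<Omega> \<Longrightarrow> ((\<lambda>y. w (fst z, y)) has_real_derivative partial_y w z) (at (snd z))"
    and "partial_y w \<in> poly_tensor N"
proof -
  have swap: "w \<circ> prod.swap \<in> poly_tensor N" if w: "w \<in> poly_tensor N" for w
  proof -
    obtain m r s where deg: "\<And>i. i < m \<Longrightarrow> degree (r i) \<le> N" "\<And>i. i < m \<Longrightarrow> degree (s i) \<le> N"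
      and w: "\<And>x y. (x, y) \<in> \<Omega> \<Longrightarrow> w (x, y) = (\<Sum>i<(m::nat). poly (r i) x * poly (s i) y)"
      by (rule poly_tensorD[OF w]) (rule that)
    show ?thesis
      by (rule poly_tensorI[of m s N r, OF deg(2,1)]) (simp_all add: w \<Omega>_def mult.commute)
  qed
  have eq: "partial_x (w \<circ> prod.swap) \<circ> prod.swap = partial_y w"
    by (auto simp: partial_x_def partial_y_def)
  show "partial_y w \<in> poly_tensor N"
    using swap[OF poly_tensor_partial_x(2)[OF swap[OF assms]]] by (simp only: eq)
  show "((\<lambda>y. w (fst z, y)) has_real_derivative partial_y w z) (at (snd z))" if "z \<in> \<Omega>"
    using poly_tensor_partial_x(1)[OF swap[OF assms], of "prod.swap z"] that
    by (simp add: \<Omega>_def mem_Times_iff flip: eq)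
qed

lemma partial_x_cong_\<Omega>:
  assumes "\<And>z. z \<in> \<Omega> \<Longrightarrow> f z = h z" "z \<in> \<Omega>"
  shows "partial_x f z = partial_x h z"
  unfolding partial_x_def
proof (intro deriv_cong_ev refl)
  have "eventually (\<lambda>x. x \<in> {-1<..<1}) (nhds (fst z))"
    using assms(2) by (intro eventually_nhds_in_open) (auto simp: \<Omega>_def)
  then show "\<forall>\<^sub>F x in nhds (fst z). f (x, snd z) = h (x, snd z)"
    by eventually_elim (use assms in \<open>auto simp: \<Omega>_def\<close>)
qed

lemma partial_y_cong_\<Omega>:
  assumes "\<And>z. z \<in> \<Omega> \<Longrightarrow> f z = h z" "z \<in> \<Omega>"
  shows "partial_y f z = partial_y h z"
  unfolding partial_y_def
proof (intro deriv_cong_ev refl)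
  have "eventually (\<lambda>y. y \<in> {-1<..<1}) (nhds (snd z))"
    using assms(2) by (intro eventually_nhds_in_open) (auto simp: \<Omega>_def)
  then show "\<forall>\<^sub>F y in nhds (snd z). f (fst z, y) = h (fst z, y)"
    by eventually_elim (use assms in \<open>auto simp: \<Omega>_def\<close>)
qed

lemma partial_x_diff_mid:
  assumes "u k \<in> poly_tensor N" "u (k + 1) \<in> poly_tensor N" "z \<in> \<Omega>"
  shows "partial_x (diff_mid \<tau> u k) z = diff_mid \<tau> (\<lambda>n. partial_x (u n)) k z"
  unfolding partial_x_def[of "diff_mid \<tau> u k"] diff_mid_def real_scaleR_def
  by (rule DERIV_imp_deriv)
    (intro DERIV_cmult DERIV_diff poly_tensor_partial_x(1)[OF assms(1,3)] poly_tensor_partial_x(1)[OF assms(2,3)])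

lemma partial_y_diff_mid:
  assumes "u k \<in> poly_tensor N" "u (k + 1) \<in> poly_tensor N" "z \<in> \<Omega>"
  shows "partial_y (diff_mid \<tau> u k) z = diff_mid \<tau> (\<lambda>n. partial_y (u n)) k z"
  unfolding partial_y_def[of "diff_mid \<tau> u k"] diff_mid_def real_scaleR_def
  by (rule DERIV_imp_deriv)
    (intro DERIV_cmult DERIV_diff poly_tensor_partial_y(1)[OF assms(1,3)] poly_tensor_partial_y(1)[OF assms(2,3)])

text \<open>
  This puts the splitting term into the form required by \<open>L2_inner_diff_mid\<close>. The partial
  derivatives are defined pointwise by \<open>deriv\<close> and are additive only where the functions are
  differentiable, hence the restriction to the square.
\<close>

lemma partial_xy_diff_mid:
  assumes "u k \<in> poly_tensor N" "u (k + 1) \<in> poly_tensor N" "z \<in> \<Omega>"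
  shows "partial_x (partial_y (diff_mid \<tau> u k)) z
    = diff_mid \<tau> (\<lambda>n. partial_x (partial_y (u n))) k z"
  using partial_x_cong_\<Omega>[OF partial_y_diff_mid[OF assms(1,2)] assms(3)]
    partial_x_diff_mid[of "\<lambda>n. partial_y (u n)" k N z] assms
  by (simp add: poly_tensor_partial_y)

lemma grad_L2:
  assumes "w \<in> poly_tensor N" shows "grad w \<in> L2"
proof -
  have "(\<lambda>z. partial_x w z *\<^sub>R (1::real, 0::real) + partial_y w z *\<^sub>R (0::real, 1::real)) \<in> L2"
    using assms by (intro L2_add L2_scaleR_vector poly_tensor_L2 poly_tensor_partial_x(2) poly_tensor_partial_y(2))
  then show ?thesis by (simp add: grad_def[abs_def])
qed

section \<open>Sign of the summed fractional terms\<close>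

text \<open>
  The convolution at level $k+1$ has one term more than the one at level $k$, and that term
  contains the initial value. If it vanishes, both run over $j\le k$ and can be averaged termwise.
\<close>

lemma frac_mid_eq_mean_mid_convolution:
  assumes "w 0 z = 0"
  shows "frac_mid \<tau> \<gamma> w k z
    = \<tau> powr (- \<gamma>) *\<^sub>R (\<Sum>j\<le>k. lambda_coeff \<gamma> j *\<^sub>R mean_mid w (k - j) z)"
proof -
  have "(\<Sum>j=0..k + 1. lambda_coeff \<gamma> j *\<^sub>R w (k + 1 - j) z)
      = (\<Sum>j\<le>k. lambda_coeff \<gamma> j *\<^sub>R w (k + 1 - j) z)"
    using assms by (simp add: atLeast0AtMost)
  also have "\<dots> = (\<Sum>j\<le>k. lambda_coeff \<gamma> j *\<^sub>R w (k - j + 1) z)"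
    by (intro sum.cong refl) (simp add: Suc_diff_le)
  finally have "frac_mid \<tau> \<gamma> w k z = inverse 2 *\<^sub>R
     (\<tau> powr (- \<gamma>) *\<^sub>R (\<Sum>j\<le>k. lambda_coeff \<gamma> j *\<^sub>R w (k - j + 1) z)
      + \<tau> powr (- \<gamma>) *\<^sub>R (\<Sum>j\<le>k. lambda_coeff \<gamma> j *\<^sub>R w (k - j) z))"
    unfolding frac_mid_def mean_mid_def frac_diff_def by (simp only: atLeast0AtMost)
  also have "\<dots> = \<tau> powr (- \<gamma>) *\<^sub>R (\<Sum>j\<le>k. lambda_coeff \<gamma> j *\<^sub>R mean_mid w (k - j) z)"
    unfolding mean_mid_def
    by (simp add: scaleR_sum_right sum.distrib scaleR_add_right mult_ac)
  finally show ?thesis .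
qed

text \<open>The form splits into one scalar form for each coordinate.\<close>

lemma lambda_coeff_convolution_inner_nonneg:
  fixes v :: "nat \<Rightarrow> 'a::euclidean_space"
  assumes "\<bar>\<gamma>\<bar> \<le> 1"
  shows "0 \<le> (\<Sum>k<n. (\<Sum>j\<le>k. lambda_coeff \<gamma> j *\<^sub>R v (k - j)) \<bullet> v k)"
proof -
  have "0 \<le> (\<Sum>b\<in>Basis. \<Sum>k<n. \<Sum>j\<le>k. lambda_coeff \<gamma> j * (v (k - j) \<bullet> b) * (v k \<bullet> b))"
    by (intro sum_nonneg lambda_coeff_convolution_nonneg assms)
  also have "\<dots> = (\<Sum>k<n. \<Sum>b\<in>Basis. (\<Sum>j\<le>k. lambda_coeff \<gamma> j *\<^sub>R v (k - j)) \<bullet> b * (v k \<bullet> b))"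
    by (subst sum.swap) (simp add: inner_sum_left sum_distrib_right)
  also have "\<dots> = (\<Sum>k<n. (\<Sum>j\<le>k. lambda_coeff \<gamma> j *\<^sub>R v (k - j)) \<bullet> v k)"
    by (intro sum.cong refl euclidean_inner[symmetric])
  finally show ?thesis .
qed

lemma frac_mid_form_nonneg:
  fixes w :: "nat \<Rightarrow> real \<times> real \<Rightarrow> 'a::euclidean_space"
  assumes \<gamma>: "\<bar>\<gamma>\<bar> \<le> 1"
    and w: "\<And>j. j \<le> n \<Longrightarrow> w j \<in> L2" and w0: "\<And>z. z \<in> \<Omega> \<Longrightarrow> w 0 z = 0"
  shows "0 \<le> (\<Sum>k<n. L2_inner (frac_mid \<tau> \<gamma> w k) (w (k + 1)) + L2_inner (frac_mid \<tau> \<gamma> w k) (w k))"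
proof -
  have L2: "frac_mid \<tau> \<gamma> w k \<in> L2" "(\<lambda>z. w (k + 1) z + w k z) \<in> L2" if "k < n" for k
    using w that by (auto intro!: frac_mid_L2 L2_add)
  have "(\<Sum>k<n. L2_inner (frac_mid \<tau> \<gamma> w k) (w (k + 1)) + L2_inner (frac_mid \<tau> \<gamma> w k) (w k))
    = (\<Sum>k<n. L2_inner (frac_mid \<tau> \<gamma> w k) (\<lambda>z. w (k + 1) z + w k z))"
    using w L2(1) by (intro sum.cong refl L2_inner_add_right) auto
  also have "\<dots> = (LINT z|lebesgue_on \<Omega>. (\<Sum>k<n. frac_mid \<tau> \<gamma> w k z \<bullet> (w (k + 1) z + w k z)))"
    unfolding L2_inner_def using L2 by (subst Bochner_Integration.integral_sum) (auto intro: L2_mult_integrable)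
  also have "\<dots> \<ge> 0"
  proof (rule Bochner_Integration.integral_nonneg_AE, rule AE_I2)
    fix z assume "z \<in> space (lebesgue_on \<Omega>)"
    then have "w 0 z = 0" using w0 by simp
    have "w (k + 1) z + w k z = 2 *\<^sub>R mean_mid w k z" for k
      by (simp add: mean_mid_def)
    then have "(\<Sum>k<n. frac_mid \<tau> \<gamma> w k z \<bullet> (w (k + 1) z + w k z))
      = 2 * \<tau> powr (- \<gamma>) *
        (\<Sum>k<n. (\<Sum>j\<le>k. lambda_coeff \<gamma> j *\<^sub>R mean_mid w (k - j) z) \<bullet> mean_mid w k z)"
      unfolding frac_mid_eq_mean_mid_convolution[where w = w, OF \<open>w 0 z = 0\<close>]
      by (simp add: sum_distrib_left mult_ac)
    also have "\<dots> \<ge> 0"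
      by (intro mult_nonneg_nonneg lambda_coeff_convolution_inner_nonneg \<gamma>) auto
    finally show "0 \<le> (\<Sum>k<n. frac_mid \<tau> \<gamma> w k z \<bullet> (w (k + 1) z + w k z))" .
  qed
  finally show ?thesis .
qed

section \<open>Stability\<close>

text \<open>
  The recursion is dominated by the one with equality and the constant datum $S_n$, whose solution is
  $(1+c)^k S_n$ by the geometric sum; monotonicity of $S$ allows this comparison.
\<close>

lemma discrete_gronwall:
  fixes E S :: "nat \<Rightarrow> real"
  assumes c: "c \<ge> 0" and S: "incseq S" "\<And>n. S n \<ge> 0"
    and rec: "\<And>n. n \<le> m \<Longrightarrow> E n \<le> S n + c * (\<Sum>k<n. E k)"
    and n: "n \<le> m"
  shows "E n \<le> exp (c * real n) * S n"
proof -
  have geom: "S n + c * (\<Sum>k<n. (1 + c) ^ k * S n) = (1 + c) ^ n * S n" for n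
  proof -
    have "c * (\<Sum>k<n. (1 + c) ^ k) = (1 + c) ^ n - 1"
      using power_diff_1_eq[of "1 + c" n] by simp
    then have "c * (\<Sum>k<n. (1 + c) ^ k) * S n = ((1 + c) ^ n - 1) * S n" by (rule arg_cong)
    then show ?thesis by (simp add: algebra_simps flip: sum_distrib_left)
  qed
  have "E n \<le> (1 + c) ^ n * S n" using n
  proof (induction n rule: less_induct)
    case (less n)
    have "E k \<le> (1 + c) ^ k * S n" if "k < n" for k
    proof -
      have "E k \<le> (1 + c) ^ k * S k" using less that by auto
      also have "\<dots> \<le> (1 + c) ^ k * S n"
        using S(1) that c by (intro mult_left_mono) (auto simp: incseq_def)
      finally show ?thesis .
    qed
    then have "S n + c * (\<Sum>k<n. E k) \<le> S n + c * (\<Sum>k<n. (1 + c) ^ k * S n)"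
      using c by (intro add_left_mono mult_left_mono sum_mono) auto
    then show ?case using rec[OF less.prems] geom[of n] by linarith
  qed
  also have "(1 + c) ^ n \<le> exp c ^ n" using c by (intro power_mono) auto
  then have "(1 + c) ^ n * S n \<le> exp (c * real n) * S n"
    using S(2) by (intro mult_right_mono) (auto simp: exp_of_nat_mult mult.commute[of c])
  finally show ?thesis .
qed

theorem theorem1:
  fixes T \<tau> \<mu> \<alpha> \<beta> p q :: real
    and M N Q Q' :: nat
    and a \<alpha>s \<beta>s :: "nat \<Rightarrow> real"
    and f g :: "real \<times> real \<Rightarrow> real \<Rightarrow> real"
    and g2 :: "real \<times> real \<Rightarrow> real"
    and u :: "nat \<Rightarrow> real \<times> real \<Rightarrow> real"
  assumes T_pos: "T > 0" and M_pos: "M > 0" and N_pos: "N > 0"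
    and tau: "\<tau> = T / real M"
    and mu_pos: "\<mu> > 0"
    and a_pos: "\<And>j. j \<in> {1..Q} \<Longrightarrow> a j > 0"
    and alpha: "1 < \<alpha>" "\<alpha> < 2"
    and alphas_decreasing: "strict_antimono_on {1..Q} \<alpha>s"
    and alphas_less: "\<And>j. j \<in> {1..Q} \<Longrightarrow> \<alpha>s j < \<alpha>"
    and alphas_pos: "\<And>j. j \<in> {1..Q} \<Longrightarrow> 0 < \<alpha>s j"
    and Q': "Q' + 1 \<le> Q" "\<alpha>s (Q' + 1) = 1"
    and beta: "\<beta> = \<alpha> - 1"
    and betas: "\<And>j. j \<in> {1..Q} \<Longrightarrow> \<beta>s j = \<alpha>s j - \<alpha> + 1"
    and g: "\<And>z t. z \<in> \<Omega> \<Longrightarrow> 0 \<le> t \<Longrightarrow> t \<le> T \<Longrightarrow>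
              g z t = g2 z + (\<Sum>j=1..Q'. a j * RL_integral (\<alpha> - \<alpha>s j) (\<lambda>_. g2 z) t)
                        + RL_integral \<beta> (f z) t"
    and g_defined: "\<And>n. n \<le> M \<Longrightarrow> AE z in lebesgue_on \<Omega>.
              set_integrable lebesgue {0..real n * \<tau>}
                (\<lambda>s. (real n * \<tau> - s) powr (\<beta> - 1) * f z s)"
    and g_L2: "\<And>n. n \<le> M \<Longrightarrow> on_grid \<tau> g n \<in> L2"
    and p: "p > 0"
      "p\<^sup>2 = 1 + 1 / 2 * (\<Sum>i=1..Q. a i * lambda_coeff (\<beta>s i) 0 * \<tau> powr (1 - \<beta>s i))"
    and q: "q = \<mu> / 2 * lambda_coeff (- \<beta>) 0 * \<tau> powr (1 + \<beta>)"
    and u_0: "\<And>z. z \<in> \<Omega> \<Longrightarrow> u 0 z = 0"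
    and u_V0: "\<And>n. n \<in> {1..M} \<Longrightarrow> u n \<in> V0 N"
    and scheme: "\<And>k v. k < M \<Longrightarrow> v \<in> V0 N \<Longrightarrow>
        L2_inner (diff_mid \<tau> u k) v
        + (\<Sum>i=1..Q. a i * L2_inner (frac_mid \<tau> (\<beta>s i) u k) v)
        + q\<^sup>2 / p\<^sup>2 * L2_inner (partial_x (partial_y (diff_mid \<tau> u k))) (partial_x (partial_y v))
        = - \<mu> * L2_inner (frac_mid \<tau> (- \<beta>) (\<lambda>n. grad (u n)) k) (grad v)
          + L2_inner (mean_mid (on_grid \<tau> g) k) v"
    and tau_less: "\<tau> < 1"
  shows "\<forall>n\<in>{1..M}. (L2_norm (u n))\<^sup>2
           \<le> exp (2 * T) * (2 * \<tau> * (\<Sum>k=0..n-1. (L2_norm (mean_mid (on_grid \<tau> g) k))\<^sup>2))"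
proof -
  have tau_pos: "\<tau> > 0" using tau T_pos M_pos by simp
  define W where "W n = grad (u n)" for n
  (* The squared L2 norms of X are the telescoping quantity of the splitting term. *)
  define X where "X n = partial_x (partial_y (u n))" for n
  define G where "G k = (L2_norm (mean_mid (on_grid \<tau> g) k))\<^sup>2" for k
  define E where "E n = (L2_norm (u n))\<^sup>2" for n
  define r where "r = q\<^sup>2 / p\<^sup>2"

  have u: "u n \<in> poly_tensor N" if "n \<le> M" for n
  proof (cases "n = 0")
    case True
    show ?thesis
      unfolding True by (rule poly_tensorI[of 0 "\<lambda>_. 0" N "\<lambda>_. 0"]) (simp_all add: u_0)
  next
    case False
    then show ?thesis using u_V0[of n] that by (auto simp: V0_def)
  qed
  have u_L2: "u n \<in> L2" and W_L2: "W n \<in> L2" and X_L2: "X n \<in> L2" if "n \<le> M" for n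
    using u[OF that] poly_tensor_L2 poly_tensor_partial_x(2) poly_tensor_partial_y(2) grad_L2
    unfolding W_def X_def by blast+
  have partial_0: "partial_x w z = 0" "partial_y w z = 0"
    if "\<And>z. z \<in> \<Omega> \<Longrightarrow> w z = 0" "z \<in> \<Omega>" for w z
    using partial_x_cong_\<Omega>[of w "\<lambda>_. 0" z] partial_y_cong_\<Omega>[of w "\<lambda>_. 0" z] that
    by (simp_all add: partial_x_def partial_y_def)
  have W_0: "W 0 z = 0" and X_0: "X 0 z = 0" if "z \<in> \<Omega>" for z
    unfolding W_def X_def grad_def using that by (simp_all add: partial_0 u_0 zero_prod_def)
  have beta_abs: "\<bar>- \<beta>\<bar> \<le> 1" using beta alpha by simp
  have betas_abs: "\<bar>\<beta>s i\<bar> \<le> 1" if "i \<in> {1..Q}" for i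
    using betas[OF that] alphas_less[OF that] alphas_pos[OF that] alpha by simp
  have r: "r \<ge> 0" by (simp add: r_def)
  have g_L2': "mean_mid (on_grid \<tau> g) k \<in> L2" if "k < M" for k
    using that by (intro mean_mid_L2 g_L2) auto

  (* The scheme, also tested with u 0: this function and its derivatives vanish on the square,
     so that both sides are 0. *)
  have test: "L2_inner (diff_mid \<tau> u k) (u j)
        + (\<Sum>i=1..Q. a i * L2_inner (frac_mid \<tau> (\<beta>s i) u k) (u j))
        + r * L2_inner (diff_mid \<tau> X k) (X j)
        = - \<mu> * L2_inner (frac_mid \<tau> (- \<beta>) W k) (W j)
          + L2_inner (mean_mid (on_grid \<tau> g) k) (u j)"
    if k: "k < M" and j: "j \<le> M" for k j
  proof (cases "j = 0")
    case True
    then show ?thesis by (simp add: L2_inner_zero_right u_0 X_0 W_0)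
  next
    case False
    have "L2_inner (partial_x (partial_y (diff_mid \<tau> u k))) (partial_x (partial_y (u j)))
        = L2_inner (diff_mid \<tau> X k) (X j)"
      unfolding X_def using k by (intro L2_inner_cong partial_xy_diff_mid[where N = N] u) auto
    then show ?thesis
      using scheme[OF k u_V0[of j]] False j by (simp add: r_def W_def[abs_def])
  qed

  (* Young's inequality is applied before the summation over k, the sign of A and B after it:
     the individual A i k and B k may be negative. *)
  define A where "A i k = L2_inner (frac_mid \<tau> (\<beta>s i) u k) (u (k + 1))
      + L2_inner (frac_mid \<tau> (\<beta>s i) u k) (u k)" for i k
  define B where "B k = L2_inner (frac_mid \<tau> (- \<beta>) W k) (W (k + 1))
      + L2_inner (frac_mid \<tau> (- \<beta>) W k) (W k)" for k
  have step: "(E (k + 1) - E k) / \<tau> + (\<Sum>i=1..Q. a i * A i k)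
      + r * (((L2_norm (X (k + 1)))\<^sup>2 - (L2_norm (X k))\<^sup>2) / \<tau>) + \<mu> * B k
      \<le> G k + (E (k + 1) + E k) / 2" if k: "k < M" for k
  proof -
    have le: "k \<le> M" "k + 1 \<le> M" using k by auto
    have "(\<Sum>i=1..Q. a i * A i k) =
        (\<Sum>i=1..Q. a i * L2_inner (frac_mid \<tau> (\<beta>s i) u k) (u (k + 1)))
      + (\<Sum>i=1..Q. a i * L2_inner (frac_mid \<tau> (\<beta>s i) u k) (u k))"
      by (simp add: A_def distrib_left sum.distrib)
    then have "(L2_inner (diff_mid \<tau> u k) (u (k + 1)) + L2_inner (diff_mid \<tau> u k) (u k))
        + (\<Sum>i=1..Q. a i * A i k)
        + r * (L2_inner (diff_mid \<tau> X k) (X (k + 1)) + L2_inner (diff_mid \<tau> X k) (X k))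
        + \<mu> * B k
        = L2_inner (mean_mid (on_grid \<tau> g) k) (u (k + 1)) + L2_inner (mean_mid (on_grid \<tau> g) k) (u k)"
      using test[OF k le(1)] test[OF k le(2)] by (simp add: B_def distrib_left)
    then show ?thesis
      using L2_inner_diff_mid[OF u_L2[OF le(1)] u_L2[OF le(2)], of \<tau>]
        L2_inner_diff_mid[OF X_L2[OF le(1)] X_L2[OF le(2)], of \<tau>]
        L2_young_mid[OF g_L2'[OF k] u_L2[OF le(1)] u_L2[OF le(2)]]
      by (simp add: E_def G_def)
  qed

  have E_0: "E 0 = 0" and X_norm_0: "L2_norm (X 0) = 0"
    by (simp_all add: E_def L2_norm_def L2_inner_zero_right u_0 X_0)

  define S where "S n = 2 * \<tau> * (\<Sum>k<n. G k)" for n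
  have rec: "E n \<le> S n + (2 * \<tau>) * (\<Sum>k<n. E k)" if n: "n \<le> M" for n
  proof -
    have A_nonneg: "0 \<le> (\<Sum>k<n. A i k)" if "i \<in> {1..Q}" for i
      unfolding A_def using n by (intro frac_mid_form_nonneg betas_abs that u_L2 u_0) auto
    have "0 \<le> (\<Sum>i=1..Q. a i * (\<Sum>k<n. A i k))"
      by (rule sum_nonneg, rule mult_nonneg_nonneg) (auto intro: A_nonneg less_imp_le[OF a_pos])
    also have "\<dots> = (\<Sum>k<n. \<Sum>i=1..Q. a i * A i k)"
      unfolding sum_distrib_left by (rule sum.swap)
    finally have damping: "0 \<le> (\<Sum>k<n. \<Sum>i=1..Q. a i * A i k)" .
    have B_nonneg: "0 \<le> (\<Sum>k<n. B k)"
      unfolding B_def using n by (intro frac_mid_form_nonneg beta_abs W_L2 W_0) auto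
    have tele: "(\<Sum>k<n. F (k + 1) - F k) = F n - F 0" for F :: "nat \<Rightarrow> real"
      by (simp add: sum_lessThan_telescope)
    have "(\<Sum>k<n. (E (k + 1) - E k) / \<tau> + (\<Sum>i=1..Q. a i * A i k)
        + r * (((L2_norm (X (k + 1)))\<^sup>2 - (L2_norm (X k))\<^sup>2) / \<tau>) + \<mu> * B k)
        \<le> (\<Sum>k<n. G k + (E (k + 1) + E k) / 2)"
      using n by (intro sum_mono step) auto
    also have "(\<Sum>k<n. (E (k + 1) - E k) / \<tau> + (\<Sum>i=1..Q. a i * A i k)
        + r * (((L2_norm (X (k + 1)))\<^sup>2 - (L2_norm (X k))\<^sup>2) / \<tau>) + \<mu> * B k)
        = E n / \<tau> + (\<Sum>k<n. \<Sum>i=1..Q. a i * A i k)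
          + r * ((L2_norm (X n))\<^sup>2 / \<tau>) + \<mu> * (\<Sum>k<n. B k)"
      unfolding sum.distrib sum_distrib_left[symmetric] sum_divide_distrib[symmetric]
      using tele[of E] tele[of "\<lambda>k. (L2_norm (X k))\<^sup>2"] by (simp add: E_0 X_norm_0)
    also have "(\<Sum>k<n. G k + (E (k + 1) + E k) / 2) = (\<Sum>k<n. G k) + (\<Sum>k<n. E k) + E n / 2"
      using tele[of E] by (simp add: E_0 sum.distrib sum_subtractf add_divide_distrib flip: sum_divide_distrib)
    finally have "E n / \<tau> \<le> (\<Sum>k<n. G k) + (\<Sum>k<n. E k) + E n / 2"
      using damping mult_nonneg_nonneg[OF less_imp_le[OF mu_pos] B_nonneg]
        mult_nonneg_nonneg[OF r, of "(L2_norm (X n))\<^sup>2 / \<tau>"] tau_pos by simp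
    then have "E n \<le> \<tau> * ((\<Sum>k<n. G k) + (\<Sum>k<n. E k)) + \<tau> * E n / 2"
      using tau_pos by (simp add: field_simps)
    (* Here \<tau> < 1 is used: it bounds the implicit term on the right by E n / 2. *)
    moreover have "\<tau> * E n \<le> E n"
      using tau_pos tau_less by (intro mult_left_le_one_le) (auto simp: E_def)
    ultimately show ?thesis by (simp add: S_def algebra_simps)
  qed

  have S_mono: "incseq S"
    unfolding S_def incseq_def using tau_pos
    by (auto simp: G_def intro!: mult_left_mono sum_mono2)
  have S_nonneg: "S n \<ge> 0" for n
    unfolding S_def using tau_pos by (auto simp: G_def intro!: mult_nonneg_nonneg sum_nonneg)
  show ?thesis
  proof
    fix n assume n: "n \<in> {1..M}"
    have "E n \<le> exp ((2 * \<tau>) * real n) * S n"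
      using tau_pos n by (intro discrete_gronwall[OF _ S_mono S_nonneg rec]) auto
    also have "\<dots> \<le> exp (2 * T) * S n"
    proof (intro mult_right_mono S_nonneg)
      have "\<tau> * real n \<le> \<tau> * real M" using n tau_pos by (intro mult_left_mono) auto
      also have "\<dots> = T" using tau M_pos by simp
      finally show "exp ((2 * \<tau>) * real n) \<le> exp (2 * T)" by simp
    qed
    also have "S n = 2 * \<tau> * (\<Sum>k=0..n-1. G k)"
      using n unfolding S_def by (intro arg_cong[where f = "(*) _"] sum.cong) auto
    finally show "(L2_norm (u n))\<^sup>2
        \<le> exp (2 * T) * (2 * \<tau> * (\<Sum>k=0..n-1. (L2_norm (mean_mid (on_grid \<tau> g) k))\<^sup>2))"
      by (simp only: E_def G_def)
  qed
qed

end
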